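(* Let $G$ be a finite simple graph on $n\geq 2$ vertices and $m$ edges, and let $\alpha$ be a real number. Then: (1) If $0<\alpha<1$, then $SO_\alpha(G)\geq F(G)^{\alpha/2}$, where equality holds if and only if $G=K_2\cup\overline{K_{n-2}}$ or $G=\overline{K_n}$. (2) If $\alpha<0$, then $SO_\alpha(G)\leq 2^{-1+\alpha/2}\,n(n-1)$, where equality holds if and only if $G=K_2$. (3) If $\alpha>1$, then $SO_\alpha(G)\leq 2^{\alpha/2}\,m\,(n-1)^\alpha$, where equality holds if and only if $G=K_n$ or $G=\overline{K_n}$.
   Context: All graphs are finite and simple. $d_G(u)$ denotes the degree of the vertex $u$ in $G$. For real $\alpha$, the general Sombor index is $SO_\alpha(G)=\sum_{uv\in E(G)}[d_G(u)^2+d_G(v)^2]^{\alpha/2}$ (an empty sum is $0$). The forgotten index is $F(G)=\sum_{u\in V(G)}d_G(u)^3=\sum_{uv\in E(G)}[d_G(u)^2+d_G(v)^2]$. $K_n$ is the complete graph on $n$ vertices, $\overline{G}$ is the complement of $G$ (so $\overline{K_n}$ is the edgeless graph on $n$ vertices), and $\cup$ denotes disjoint union. Equality of graphs means isomorphism. *)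

theory Defs
  imports Complex_Main "HOL-Library.Ramsey"
begin

datatype 'a ugraph = Graph (verts: "'a set") (edges: "'a set set")

definition fin_simple_graph :: "'a ugraph \<Rightarrow> bool" where
  "fin_simple_graph G \<longleftrightarrow> finite (verts G) \<and> edges G \<subseteq> [verts G]\<^bsup>2\<^esup>"

definition degree :: "'a ugraph \<Rightarrow> 'a \<Rightarrow> nat" where
  "degree G u = card {e \<in> edges G. u \<in> e}"

(* The inner sum ranges over the two endpoints of the edge e; see general_sombor_summand. *)
definition general_sombor :: "real \<Rightarrow> 'a ugraph \<Rightarrow> real" where
  "general_sombor \<alpha> G = (\<Sum>e\<in>edges G. (\<Sum>u\<in>e. (real (degree G u))\<^sup>2) powr (\<alpha> / 2))"

definition forgotten_index :: "'a ugraph \<Rightarrow> nat" where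
  "forgotten_index G = (\<Sum>u\<in>verts G. degree G u ^ 3)"

definition graph_complement :: "'a ugraph \<Rightarrow> 'a ugraph" where
  "graph_complement G = Graph (verts G) ([verts G]\<^bsup>2\<^esup> - edges G)"

definition complete_graph :: "nat \<Rightarrow> nat ugraph" where
  "complete_graph n = Graph {..<n} ([{..<n}]\<^bsup>2\<^esup>)"

definition disjoint_union :: "'a ugraph \<Rightarrow> 'b ugraph \<Rightarrow> ('a + 'b) ugraph" where
  "disjoint_union G H =
     Graph (verts G <+> verts H) ((`) Inl ` edges G \<union> (`) Inr ` edges H)"

definition graph_iso :: "'a ugraph \<Rightarrow> 'b ugraph \<Rightarrow> bool" where
  "graph_iso G H \<longleftrightarrow> (\<exists>f. bij_betw f (verts G) (verts H) \<and> (`) f ` edges G = edges H)"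

lemma general_sombor_summand:
  assumes "u \<noteq> v"
  shows "(\<Sum>w\<in>{u, v}. (real (degree G w))\<^sup>2) = (real (degree G u))\<^sup>2 + (real (degree G v))\<^sup>2"
  using assms by simp

lemma forgotten_index_edges:
  assumes "fin_simple_graph G"
  shows "forgotten_index G = (\<Sum>e\<in>edges G. \<Sum>u\<in>e. (degree G u)\<^sup>2)"
proof -
  have fV: "finite (verts G)" and sub: "\<And>e. e \<in> edges G \<Longrightarrow> e \<subseteq> verts G"
    using assms by (auto simp: fin_simple_graph_def nsets_def)
  have fE: "finite (edges G)"
    using assms by (meson fin_simple_graph_def finite_imp_finite_nsets finite_subset)
  have "(\<Sum>e\<in>edges G. \<Sum>u\<in>e. (degree G u)\<^sup>2)
      = (\<Sum>e\<in>edges G. \<Sum>u\<in>{u \<in> verts G. u \<in> e}. (degree G u)\<^sup>2)"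
    using sub by (intro sum.cong) auto
  also have "\<dots> = (\<Sum>u\<in>verts G. \<Sum>e\<in>{e \<in> edges G. u \<in> e}. (degree G u)\<^sup>2)"
    by (rule sum.swap_restrict[OF fE fV])
  also have "\<dots> = forgotten_index G"
    by (simp add: forgotten_index_def degree_def power3_eq_cube power2_eq_square algebra_simps)
  finally show ?thesis by simp
qed

lemma fin_simple_graph_complete: "fin_simple_graph (complete_graph n)"
  by (simp add: fin_simple_graph_def complete_graph_def)

lemma fin_simple_graph_complement:
  "fin_simple_graph G \<Longrightarrow> fin_simple_graph (graph_complement G)"
  by (auto simp: fin_simple_graph_def graph_complement_def)

lemma edges_complement_complete: "edges (graph_complement (complete_graph n)) = {}"
  by (simp add: graph_complement_def complete_graph_def)

lemma fin_simple_graph_disjoint_union: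
  assumes "fin_simple_graph G" and "fin_simple_graph H"
  shows "fin_simple_graph (disjoint_union G H)"
proof -
  have "Inl ` e \<in> [verts G <+> verts H]\<^bsup>2\<^esup>" if "e \<in> edges G" for e
  proof -
    have "e \<subseteq> verts G" "finite e" "card e = 2"
      using that assms(1) by (auto simp: fin_simple_graph_def nsets_def)
    then show ?thesis
      by (auto simp: nsets_def card_image)
  qed
  moreover have "Inr ` e \<in> [verts G <+> verts H]\<^bsup>2\<^esup>" if "e \<in> edges H" for e
  proof -
    have "e \<subseteq> verts H" "finite e" "card e = 2"
      using that assms(2) by (auto simp: fin_simple_graph_def nsets_def)
    then show ?thesis
      by (auto simp: nsets_def card_image)
  qed
  ultimately show ?thesis
    using assms by (auto simp: fin_simple_graph_def disjoint_union_def)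
qed

end

theory Submission
  imports Defs
begin

text \<open>Every edge weight $d(u)^2 + d(v)^2$ lies between $2$ (both endpoints have degree $1$) and
  $2(n-1)^2$ (both endpoints are adjacent to every other vertex). Parts (2) and (3) bound each
  summand by the appropriate extreme; part (1) is the strict subadditivity of $x \mapsto x^{\alpha/2}$
  applied to the edge weights, whose sum is the forgotten index. In all equality cases the graph is
  determined up to isomorphism by its numbers of vertices and edges.\<close>

section \<open>Strict subadditivity of powers with exponent below 1\<close>

text \<open>With \<open>s\<close> the total, \<open>s powr p\<close> splits as the sum of the terms
  \<open>f x * s powr (p - 1)\<close>. As \<open>p - 1\<close> is negative and each
  \<open>f x\<close> is smaller than \<open>s\<close>, replacing \<open>s\<close> by
  \<open>f x\<close> in the power strictly increases every term.\<close>

lemma powr_sum_less_sum_powr: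
  fixes f :: "'b \<Rightarrow> real"
  assumes "card A \<ge> 2" and pos: "\<And>x. x \<in> A \<Longrightarrow> f x > 0" and p: "p < 1"
  shows "(\<Sum>x\<in>A. f x) powr p < (\<Sum>x\<in>A. f x powr p)"
proof -
  have fin: "finite A" and ne: "A \<noteq> {}"
    using assms(1) by (auto intro: card_ge_0_finite)
  define s where "s = (\<Sum>x\<in>A. f x)"
  have spos: "s > 0"
    unfolding s_def using fin ne pos by (intro sum_pos)
  have less: "f x < s" if x: "x \<in> A" for x
  proof -
    \<comment> \<open>The second element makes the inequality strict: some positive summand is left
      besides \<open>f x\<close>.\<close>
    have "card (A - {x}) > 0"
      using assms(1) x fin by (simp add: card_Diff_singleton)
    then have "A - {x} \<noteq> {}"
      by force
    then have "(\<Sum>y\<in>A - {x}. f y) > 0"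
      using fin pos by (intro sum_pos) auto
    then show ?thesis
      unfolding s_def using sum.remove[OF fin x, of f] by simp
  qed
  have "s powr p = s * s powr (p - 1)"
    using spos by (simp add: powr_mult_base)
  also have "\<dots> = (\<Sum>x\<in>A. f x * s powr (p - 1))"
    by (simp add: s_def sum_distrib_right)
  also have "\<dots> < (\<Sum>x\<in>A. f x powr p)"
  proof (rule sum_strict_mono[OF fin ne])
    fix x assume x: "x \<in> A"
    have "s powr (p - 1) < f x powr (p - 1)"
      using p by (intro powr_less_mono2_neg pos less x) auto
    then have "f x * s powr (p - 1) < f x * f x powr (p - 1)"
      using pos[OF x] by simp
    also have "\<dots> = f x powr p"
      using pos[OF x] by (simp add: powr_mult_base)
    finally show "f x * s powr (p - 1) < f x powr p" .
  qed
  finally show ?thesis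
    by (simp add: s_def)
qed

section \<open>Edge counts and degrees in finite simple graphs\<close>

lemma fin_simple_graph_finite:
  assumes "fin_simple_graph G"
  shows "finite (verts G)" and "finite (edges G)"
  using assms by (auto simp: fin_simple_graph_def intro: finite_subset finite_imp_finite_nsets)

lemma fin_simple_graph_edgeE:
  assumes "fin_simple_graph G" and "e \<in> edges G"
  obtains u v where "e = {u, v}" "u \<noteq> v" "u \<in> verts G" "v \<in> verts G"
  using assms unfolding fin_simple_graph_def nsets_def card_2_iff by blast

lemma card_edges_le:
  assumes "fin_simple_graph G"
  shows "card (edges G) \<le> card (verts G) choose 2"
  using assms card_mono[of "[verts G]\<^bsup>2\<^esup>" "edges G"]
  by (simp add: fin_simple_graph_def finite_imp_finite_nsets card_nsets)

lemma edges_eq_nsets_iff: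
  assumes "fin_simple_graph G"
  shows "edges G = [verts G]\<^bsup>2\<^esup> \<longleftrightarrow> card (edges G) = card (verts G) choose 2"
  using assms card_subset_eq[of "[verts G]\<^bsup>2\<^esup>" "edges G"]
  by (auto simp: fin_simple_graph_def finite_imp_finite_nsets card_nsets)

lemma incident_edges_subset:
  assumes "fin_simple_graph G"
  shows "{e \<in> edges G. u \<in> e} \<subseteq> (\<lambda>v. {u, v}) ` (verts G - {u})"
proof
  fix e assume "e \<in> {e \<in> edges G. u \<in> e}"
  then show "e \<in> (\<lambda>v. {u, v}) ` (verts G - {u})"
    using fin_simple_graph_edgeE[OF assms, of e] by blast
qed

lemma card_pairs_with:
  assumes "u \<in> V"
  shows "card ((\<lambda>v. {u, v}) ` (V - {u})) = card V - 1"
proof -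
  have "inj_on (\<lambda>v. {u, v}) (V - {u})"
    by (auto simp: inj_on_def doubleton_eq_iff)
  then show ?thesis
    using assms by (simp add: card_image)
qed

lemma degree_le:
  assumes "fin_simple_graph G" and "u \<in> verts G"
  shows "degree G u \<le> card (verts G) - 1"
  unfolding degree_def card_pairs_with[OF assms(2), symmetric]
  using assms fin_simple_graph_finite
  by (intro card_mono incident_edges_subset finite_imageI finite_Diff) auto

text \<open>The edges at \<open>u\<close> form a subset of the \<open>card (verts G) - 1\<close>
  pairs through \<open>u\<close>, and a subset of a finite set with the same cardinality is the
  whole set.\<close>

lemma degree_eq_max_iff:
  assumes "fin_simple_graph G" and "u \<in> verts G"
  shows "degree G u = card (verts G) - 1 \<longleftrightarrow> (\<forall>v\<in>verts G. v \<noteq> u \<longrightarrow> {u, v} \<in> edges G)"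
proof
  have fin: "finite ((\<lambda>v. {u, v}) ` (verts G - {u}))"
    using assms fin_simple_graph_finite by blast
  assume "degree G u = card (verts G) - 1"
  then have "{e \<in> edges G. u \<in> e} = (\<lambda>v. {u, v}) ` (verts G - {u})"
    using card_subset_eq[OF fin incident_edges_subset[OF assms(1)]] card_pairs_with[OF assms(2)]
    by (simp add: degree_def)
  then show "\<forall>v\<in>verts G. v \<noteq> u \<longrightarrow> {u, v} \<in> edges G"
    by blast
next
  assume "\<forall>v\<in>verts G. v \<noteq> u \<longrightarrow> {u, v} \<in> edges G"
  then have "{e \<in> edges G. u \<in> e} = (\<lambda>v. {u, v}) ` (verts G - {u})"
    using incident_edges_subset[OF assms(1), of u] by blast
  then show "degree G u = card (verts G) - 1"
    using card_pairs_with[OF assms(2)] by (simp add: degree_def)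
qed

lemma degree_pos:
  assumes "fin_simple_graph G" and "e \<in> edges G" and "u \<in> e"
  shows "degree G u \<ge> 1"
proof -
  have "finite {e \<in> edges G. u \<in> e}" "{e \<in> edges G. u \<in> e} \<noteq> {}"
    using assms fin_simple_graph_finite(2)[OF assms(1)] by auto
  then show ?thesis
    by (simp add: degree_def Suc_le_eq card_gt_0_iff)
qed

section \<open>Extreme edge weights\<close>

text \<open>Both endpoints of an edge have degree between \<open>1\<close> and
  \<open>card (verts G) - 1\<close>, so each of the two squares has its own bounds. A sum of two
  terms reaches an extreme only if both terms do.\<close>

lemma edge_weight_bounds:
  assumes "fin_simple_graph G" and "e \<in> edges G"
  shows "(\<Sum>u\<in>e. (real (degree G u))\<^sup>2) \<ge> 2"
    and "(\<Sum>u\<in>e. (real (degree G u))\<^sup>2) \<le> 2 * (real (card (verts G)) - 1)\<^sup>2"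
    and "(\<Sum>u\<in>e. (real (degree G u))\<^sup>2) = 2 \<Longrightarrow> w \<in> e \<Longrightarrow> degree G w = 1"
    and "(\<Sum>u\<in>e. (real (degree G u))\<^sup>2) = 2 * (real (card (verts G)) - 1)\<^sup>2 \<Longrightarrow> w \<in> e \<Longrightarrow>
           degree G w = card (verts G) - 1"
proof -
  obtain u v where e: "e = {u, v}" "u \<noteq> v" "u \<in> verts G" "v \<in> verts G"
    using fin_simple_graph_edgeE[OF assms] .
  define N where "N = card (verts G) - 1"
  \<comment> \<open>The subtraction in \<open>N\<close> is truncated; the vertex \<open>u\<close>
    ensures that it agrees with the real subtraction in the statement.\<close>
  have "card (verts G) \<ge> 1"
    using e fin_simple_graph_finite[OF assms(1)] by (auto simp: Suc_le_eq card_gt_0_iff)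
  then have N: "real (card (verts G)) - 1 = real N"
    by (simp add: N_def of_nat_diff)
  have lo: "1 \<le> (degree G x)\<^sup>2" if "x \<in> e" for x
    using degree_pos[OF assms that] by simp
  have hi: "(degree G x)\<^sup>2 \<le> N\<^sup>2" if "x \<in> e" for x
    using degree_le[OF assms(1), of x] e that by (auto simp: N_def intro: power_mono)
  \<comment> \<open>The weight is written as the image of a natural number, so that the claims
    become linear in the two squares of degrees.\<close>
  have W: "(\<Sum>u\<in>e. (real (degree G u))\<^sup>2) = real ((degree G u)\<^sup>2 + (degree G v)\<^sup>2)"
    using e by simp
  have bounds: "1 \<le> (degree G u)\<^sup>2" "1 \<le> (degree G v)\<^sup>2"
    "(degree G u)\<^sup>2 \<le> N\<^sup>2" "(degree G v)\<^sup>2 \<le> N\<^sup>2"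
    using lo hi e by auto
  have M: "2 * (real N)\<^sup>2 = real (2 * N\<^sup>2)"
    by simp
  show "(\<Sum>u\<in>e. (real (degree G u))\<^sup>2) \<ge> 2"
    unfolding W using bounds by linarith
  show "(\<Sum>u\<in>e. (real (degree G u))\<^sup>2) \<le> 2 * (real (card (verts G)) - 1)\<^sup>2"
    unfolding W N M of_nat_le_iff using bounds by linarith
  show "degree G w = 1" if "(\<Sum>u\<in>e. (real (degree G u))\<^sup>2) = 2" "w \<in> e"
  proof -
    have "(degree G u)\<^sup>2 = 1 \<and> (degree G v)\<^sup>2 = 1"
      using that(1) bounds unfolding W by linarith
    then show ?thesis
      using that(2) e by auto
  qed
  show "degree G w = card (verts G) - 1"
    if "(\<Sum>u\<in>e. (real (degree G u))\<^sup>2) = 2 * (real (card (verts G)) - 1)\<^sup>2" "w \<in> e"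
  proof -
    have "(degree G u)\<^sup>2 + (degree G v)\<^sup>2 = 2 * N\<^sup>2"
      using that(1) unfolding W N M of_nat_eq_iff .
    then have "(degree G u)\<^sup>2 = N\<^sup>2 \<and> (degree G v)\<^sup>2 = N\<^sup>2"
      using bounds by linarith
    then show ?thesis
      using that(2) e by (auto simp: N_def)
  qed
qed

section \<open>Recognizing the extremal graphs by their numbers of vertices and edges\<close>

text \<open>A map injective on the vertices is also injective on sets of vertices, hence on edges.
  This yields the forward direction of the three characterizations that follow.\<close>

lemma graph_iso_cards:
  assumes "fin_simple_graph G" and "graph_iso G H"
  shows "card (verts G) = card (verts H)" and "card (edges G) = card (edges H)"
proof -
  obtain f where f: "bij_betw f (verts G) (verts H)" "(`) f ` edges G = edges H"
    using assms(2) by (auto simp: graph_iso_def)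
  show "card (verts G) = card (verts H)"
    using f(1) by (rule bij_betw_same_card)
  have "inj_on ((`) f) (edges G)"
  proof (rule inj_on_subset)
    show "inj_on ((`) f) (Pow (verts G))"
      using f(1) by (intro inj_on_image_Pow) (rule bij_betw_imp_inj_on)
    show "edges G \<subseteq> Pow (verts G)"
      using assms(1) by (auto simp: fin_simple_graph_def nsets_def)
  qed
  then show "card (edges G) = card (edges H)"
    using f(2) card_image by fastforce
qed

lemma graph_iso_edgeless_iff:
  assumes "fin_simple_graph G"
  shows "graph_iso G (graph_complement (complete_graph (card (verts G)))) \<longleftrightarrow> card (edges G) = 0"
proof
  assume "graph_iso G (graph_complement (complete_graph (card (verts G))))"
  from graph_iso_cards(2)[OF assms this] show "card (edges G) = 0"
    by (simp add: edges_complement_complete)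
next
  assume "card (edges G) = 0"
  then have "edges G = {}"
    using fin_simple_graph_finite[OF assms] by simp
  moreover obtain f where "bij_betw f (verts G) {..<card (verts G)}"
    using fin_simple_graph_finite(1)[OF assms] ex_bij_betw_finite_nat atLeast0LessThan by metis
  ultimately show "graph_iso G (graph_complement (complete_graph (card (verts G))))"
    by (auto simp: graph_iso_def graph_complement_def complete_graph_def)
qed

text \<open>For the converse, the edge count leaves no pair out, so every bijection of the vertices
  carries edges exactly onto edges.\<close>

lemma graph_iso_complete_iff:
  assumes "fin_simple_graph G"
  shows "graph_iso G (complete_graph n) \<longleftrightarrow>
    card (verts G) = n \<and> card (edges G) = n choose 2"
proof
  assume "graph_iso G (complete_graph n)"
  from graph_iso_cards[OF assms this] show "card (verts G) = n \<and> card (edges G) = n choose 2"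
    by (simp add: complete_graph_def card_nsets)
next
  assume n: "card (verts G) = n \<and> card (edges G) = n choose 2"
  then have E: "edges G = [verts G]\<^bsup>2\<^esup>"
    using edges_eq_nsets_iff[OF assms] by simp
  obtain f where f: "bij_betw f (verts G) {..<n}"
    using fin_simple_graph_finite(1)[OF assms] ex_bij_betw_finite_nat atLeast0LessThan n by metis
  have "(`) f ` edges G = [{..<n}]\<^bsup>2\<^esup>"
    using bij_betw_nsets[OF f] by (simp add: E bij_betw_def)
  then show "graph_iso G (complete_graph n)"
    using f by (auto simp: graph_iso_def complete_graph_def)
qed

lemma edges_complete_graph_2: "edges (complete_graph 2) = {{0, 1}}"
  by (auto simp: complete_graph_def nsets_def card_2_iff)

lemma graph_iso_single_edge_iff:
  assumes "fin_simple_graph G"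
  shows "graph_iso G (disjoint_union (complete_graph 2)
      (graph_complement (complete_graph (card (verts G) - 2)))) \<longleftrightarrow> card (edges G) = 1"
    (is "graph_iso G ?H \<longleftrightarrow> _")
proof
  assume "graph_iso G ?H"
  from graph_iso_cards(2)[OF assms this] show "card (edges G) = 1"
    by (simp add: disjoint_union_def edges_complement_complete edges_complete_graph_2)
next
  assume "card (edges G) = 1"
  then obtain e where E: "edges G = {e}"
    by (auto simp: card_1_singleton_iff)
  then obtain u v where e: "e = {u, v}" "u \<noteq> v" "u \<in> verts G" "v \<in> verts G"
    using fin_simple_graph_edgeE[OF assms, of e] by blast
  have "card (verts G - {u, v}) = card (verts G) - 2"
    using e by (simp add: card_Diff_subset)
  then obtain g where g: "bij_betw g (verts G - {u, v}) {..<card (verts G) - 2}"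
    using fin_simple_graph_finite(1)[OF assms] ex_bij_betw_finite_nat[of "verts G - {u, v}"]
      atLeast0LessThan by (metis finite_Diff)
  \<comment> \<open>The ends of the only edge go to the two vertices of
    \<open>complete_graph 2\<close> in the left summand; \<open>g\<close> numbers all other
    vertices, which become the isolated ones on the right.\<close>
  define f :: "'a \<Rightarrow> nat + nat"
    where "f w = (if w = u then Inl 0 else if w = v then Inl 1 else Inr (g w))" for w
  have "bij_betw f {u, v} (Inl ` {..<2})"
    using e by (auto simp: bij_betw_def f_def lessThan_Suc numeral_2_eq_2)
  moreover have "bij_betw f (verts G - {u, v}) (Inr ` {..<card (verts G) - 2})"
  proof -
    have "bij_betw (Inr \<circ> g) (verts G - {u, v}) (Inr ` {..<card (verts G) - 2})"
      using g by (rule bij_betw_trans) (simp add: bij_betw_def)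
    then show ?thesis
      by (rule bij_betw_cong[THEN iffD1, rotated]) (auto simp: f_def)
  qed
  ultimately have "bij_betw f ({u, v} \<union> (verts G - {u, v}))
      (Inl ` {..<2} \<union> Inr ` {..<card (verts G) - 2})"
    by (rule bij_betw_combine) auto
  moreover have "{u, v} \<union> (verts G - {u, v}) = verts G"
    using e by blast
  ultimately have "bij_betw f (verts G) (verts ?H)"
    by (simp add: disjoint_union_def graph_complement_def complete_graph_def Plus_def)
  moreover have "(`) f ` edges G = edges ?H"
    using e by (simp add: E disjoint_union_def edges_complement_complete edges_complete_graph_2 f_def
        insert_commute)
  ultimately show "graph_iso G ?H"
    by (auto simp: graph_iso_def)
qed

section \<open>Bounds on the Sombor index and their equality conditions\<close>

text \<open>These are the edge weights that occur in \<open>general_sombor\<close>, so comparing the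
  two indices means comparing a power of a sum with a sum of powers.\<close>

lemma forgotten_index_real:
  assumes "fin_simple_graph G"
  shows "real (forgotten_index G) = (\<Sum>e\<in>edges G. \<Sum>u\<in>e. (real (degree G u))\<^sup>2)"
  by (simp add: forgotten_index_edges[OF assms])

lemma general_sombor_ge:
  assumes G: "fin_simple_graph G" and "\<alpha> < 2"
  shows "general_sombor \<alpha> G \<ge> real (forgotten_index G) powr (\<alpha> / 2)"
    and "general_sombor \<alpha> G = real (forgotten_index G) powr (\<alpha> / 2) \<longleftrightarrow>
      card (edges G) = 1 \<or> card (edges G) = 0"
proof -
  \<comment> \<open>A single edge gives a single summand on both sides. Without edges both sides are
    \<open>0\<close>, because \<open>0 powr x\<close> is \<open>0\<close>.\<close>
  have small: "general_sombor \<alpha> G = real (forgotten_index G) powr (\<alpha> / 2)"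
    if "card (edges G) = 1 \<or> card (edges G) = 0"
    using that fin_simple_graph_finite(2)[OF G]
    by (auto simp: general_sombor_def forgotten_index_real[OF G] card_1_singleton_iff)
  have big: "general_sombor \<alpha> G > real (forgotten_index G) powr (\<alpha> / 2)"
    if "card (edges G) \<ge> 2"
    unfolding general_sombor_def forgotten_index_real[OF G]
    using that assms(2) edge_weight_bounds(1)[OF G]
    by (intro powr_sum_less_sum_powr) (auto intro: less_le_trans[of 0 2])
  consider "card (edges G) = 1 \<or> card (edges G) = 0" | "card (edges G) \<ge> 2"
    by linarith
  then show "general_sombor \<alpha> G \<ge> real (forgotten_index G) powr (\<alpha> / 2)"
    by cases (use small big in auto)
  show "general_sombor \<alpha> G = real (forgotten_index G) powr (\<alpha> / 2) \<longleftrightarrow>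
      card (edges G) = 1 \<or> card (edges G) = 0"
    using small big by fastforce
qed

text \<open>A negative exponent makes the power decreasing, so every summand is largest at the least
  weight \<open>2\<close>, which is the weight of an edge with both ends of degree 1.\<close>

lemma general_sombor_le_neg:
  assumes G: "fin_simple_graph G" and \<alpha>: "\<alpha> < 0"
  shows "general_sombor \<alpha> G \<le> real (card (edges G)) * 2 powr (\<alpha> / 2)"
    and "general_sombor \<alpha> G = real (card (edges G)) * 2 powr (\<alpha> / 2) \<longleftrightarrow>
      (\<forall>e\<in>edges G. \<forall>u\<in>e. degree G u = 1)"
proof -
  let ?W = "\<lambda>e. \<Sum>u\<in>e. (real (degree G u))\<^sup>2"
  have le: "?W e powr (\<alpha> / 2) \<le> 2 powr (\<alpha> / 2)" if "e \<in> edges G" for e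
    using edge_weight_bounds(1)[OF G that] \<alpha> by (intro powr_mono2') auto
  show "general_sombor \<alpha> G \<le> real (card (edges G)) * 2 powr (\<alpha> / 2)"
    unfolding general_sombor_def using le by (rule sum_bounded_above)
  show "general_sombor \<alpha> G = real (card (edges G)) * 2 powr (\<alpha> / 2) \<longleftrightarrow>
      (\<forall>e\<in>edges G. \<forall>u\<in>e. degree G u = 1)"
  proof (intro iffI ballI)
    fix e u assume eq: "general_sombor \<alpha> G = real (card (edges G)) * 2 powr (\<alpha> / 2)"
      and e: "e \<in> edges G" and u: "u \<in> e"
    \<comment> \<open>Equal sums with termwise inequality have equal terms; strict monotonicity of
      the power then pins the weight down to \<open>2\<close>.\<close>
    have "?W e powr (\<alpha> / 2) = 2 powr (\<alpha> / 2)"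
    proof (rule sum_mono_inv[where I = "edges G"])
      show "(\<Sum>e\<in>edges G. ?W e powr (\<alpha> / 2)) = (\<Sum>e\<in>edges G. 2 powr (\<alpha> / 2))"
        using eq by (simp add: general_sombor_def)
    qed (use le e fin_simple_graph_finite[OF G] in auto)
    moreover have "?W e powr (\<alpha> / 2) < 2 powr (\<alpha> / 2)" if "?W e > 2"
      using that \<alpha> by (intro powr_less_mono2_neg) auto
    ultimately have "?W e = 2"
      using edge_weight_bounds(1)[OF G e] by fastforce
    then show "degree G u = 1"
      using edge_weight_bounds(3)[OF G e] u by blast
  next
    assume deg: "\<forall>e\<in>edges G. \<forall>u\<in>e. degree G u = 1"
    have "?W e = 2" if e: "e \<in> edges G" for e
    proof -
      have "?W e = (\<Sum>u\<in>e. 1)"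
        using deg e by (intro sum.cong) auto
      moreover have "card e = 2"
        using G e by (auto simp: fin_simple_graph_def nsets_def)
      ultimately show ?thesis
        by simp
    qed
    then show "general_sombor \<alpha> G = real (card (edges G)) * 2 powr (\<alpha> / 2)"
      by (simp add: general_sombor_def)
  qed
qed

text \<open>The increasing counterpart: \<open>c\<close> is the power of the greatest possible
  weight, attained when both ends of the edge have full degree.\<close>

lemma general_sombor_le_pos:
  assumes G: "fin_simple_graph G" and \<alpha>: "\<alpha> > 0"
  defines "c \<equiv> 2 powr (\<alpha> / 2) * (real (card (verts G)) - 1) powr \<alpha>"
  shows "general_sombor \<alpha> G \<le> real (card (edges G)) * c"
    and "general_sombor \<alpha> G = real (card (edges G)) * c \<longleftrightarrow>
      (\<forall>e\<in>edges G. \<forall>u\<in>e. degree G u = card (verts G) - 1)"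
proof -
  let ?W = "\<lambda>e. \<Sum>u\<in>e. (real (degree G u))\<^sup>2"
  let ?n = "real (card (verts G))"
  \<comment> \<open>For an empty vertex set \<open>?n - 1\<close> would be \<open>-1\<close>; an
    edge excludes this.\<close>
  have n: "?n \<ge> 1" if "e \<in> edges G" for e
    using fin_simple_graph_edgeE[OF G that] fin_simple_graph_finite[OF G]
    by (metis One_nat_def Suc_leI card_gt_0_iff empty_iff of_nat_1 of_nat_mono)
  have c: "(2 * (?n - 1)\<^sup>2) powr (\<alpha> / 2) = c" if "e \<in> edges G" for e
  proof -
    \<comment> \<open>The value \<open>?n = 1\<close> is treated apart: both sides are then powers
      of \<open>0\<close>, hence \<open>0\<close>.\<close>
    have "((?n - 1)\<^sup>2) powr (\<alpha> / 2) = (?n - 1) powr \<alpha>"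
      using n[OF that] by (cases "?n = 1") (simp_all add: powr_powr flip: powr_numeral)
    then show ?thesis
      by (simp add: c_def powr_mult)
  qed
  have le: "?W e powr (\<alpha> / 2) \<le> c" if "e \<in> edges G" for e
    unfolding c[OF that, symmetric] using edge_weight_bounds(2)[OF G that] \<alpha>
    by (intro powr_mono2) (auto intro: sum_nonneg)
  show "general_sombor \<alpha> G \<le> real (card (edges G)) * c"
    unfolding general_sombor_def using le by (rule sum_bounded_above)
  show "general_sombor \<alpha> G = real (card (edges G)) * c \<longleftrightarrow>
      (\<forall>e\<in>edges G. \<forall>u\<in>e. degree G u = card (verts G) - 1)"
  proof (intro iffI ballI)
    fix e u assume eq: "general_sombor \<alpha> G = real (card (edges G)) * c"
      and e: "e \<in> edges G" and u: "u \<in> e"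
    have "?W e powr (\<alpha> / 2) = c"
    proof (rule sum_mono_inv[where I = "edges G"])
      show "(\<Sum>e\<in>edges G. ?W e powr (\<alpha> / 2)) = (\<Sum>e\<in>edges G. c)"
        using eq by (simp add: general_sombor_def)
    qed (use le e fin_simple_graph_finite[OF G] in auto)
    moreover have "?W e powr (\<alpha> / 2) < (2 * (?n - 1)\<^sup>2) powr (\<alpha> / 2)"
      if "?W e < 2 * (?n - 1)\<^sup>2"
      using that \<alpha> by (intro powr_less_mono2) (auto intro: sum_nonneg)
    ultimately have "?W e = 2 * (?n - 1)\<^sup>2"
      using edge_weight_bounds(2)[OF G e] c[OF e] by fastforce
    then show "degree G u = card (verts G) - 1"
      using edge_weight_bounds(4)[OF G e] u by blast
  next
    assume deg: "\<forall>e\<in>edges G. \<forall>u\<in>e. degree G u = card (verts G) - 1"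
    have "?W e powr (\<alpha> / 2) = c" if e: "e \<in> edges G" for e
    proof -
      have "?W e = (\<Sum>u\<in>e. (?n - 1)\<^sup>2)"
        using deg e n[OF e] by (intro sum.cong) (auto simp: of_nat_diff)
      moreover have "card e = 2"
        using G e by (auto simp: fin_simple_graph_def nsets_def)
      ultimately show ?thesis
        using c[OF e] by simp
    qed
    then show "general_sombor \<alpha> G = real (card (edges G)) * c"
      by (simp add: general_sombor_def)
  qed
qed

section \<open>Graphs in which every endpoint of an edge has full degree\<close>

text \<open>Turns the equality condition of \<open>general_sombor_le_pos\<close> into an edge count,
  the form in which complete and edgeless graphs are recognized.\<close>

lemma all_edges_max_degree_iff:
  assumes G: "fin_simple_graph G"
  shows "(\<forall>e\<in>edges G. \<forall>u\<in>e. degree G u = card (verts G) - 1) \<longleftrightarrow>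
    card (edges G) = card (verts G) choose 2 \<or> card (edges G) = 0"
  unfolding edges_eq_nsets_iff[OF G, symmetric]
proof
  assume deg: "\<forall>e\<in>edges G. \<forall>u\<in>e. degree G u = card (verts G) - 1"
  show "edges G = [verts G]\<^bsup>2\<^esup> \<or> card (edges G) = 0"
  proof (cases "edges G = {}")
    case False
    then obtain u v where uv: "{u, v} \<in> edges G" "u \<in> verts G"
      using fin_simple_graph_edgeE[OF G] by blast
    have step: "{x, y} \<in> edges G"
      if "e \<in> edges G" "x \<in> e" "x \<in> verts G" "y \<in> verts G" "y \<noteq> x" for e x y
      using deg that degree_eq_max_iff[OF G] by blast
    \<comment> \<open>An edge at \<open>u\<close> makes \<open>u\<close> adjacent to every vertex, so no vertex is isolated.\<close>
    have "\<exists>e\<in>edges G. x \<in> e" if "x \<in> verts G" for x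
      using step[OF uv(1) _ uv(2) that] uv by blast
    \<comment> \<open>Every vertex now lies on an edge, so \<open>step\<close> joins it to all the
      others.\<close>
    then have "[verts G]\<^bsup>2\<^esup> \<subseteq> edges G"
      using step by (fastforce simp: nsets_def card_2_iff)
    then show ?thesis
      using G by (auto simp: fin_simple_graph_def)
  qed simp
next
  assume "edges G = [verts G]\<^bsup>2\<^esup> \<or> card (edges G) = 0"
  then show "\<forall>e\<in>edges G. \<forall>u\<in>e. degree G u = card (verts G) - 1"
  proof
    assume E: "edges G = [verts G]\<^bsup>2\<^esup>"
    have "degree G u = card (verts G) - 1" if "u \<in> verts G" for u
      unfolding degree_eq_max_iff[OF G that] E using that by (auto simp: nsets_def)
    then show ?thesis
      by (auto simp: E nsets_def)
  qed (simp add: fin_simple_graph_finite[OF G])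
qed

section \<open>The three inequalities with their extremal graphs\<close>

theorem theorem3p3:
  fixes G :: "'a ugraph" and n m :: nat and \<alpha> :: real
  assumes "fin_simple_graph G"
    and "card (verts G) = n" and "n \<ge> 2"
    and "card (edges G) = m"
  shows
    "(0 < \<alpha> \<and> \<alpha> < 1 \<longrightarrow>
        general_sombor \<alpha> G \<ge> real (forgotten_index G) powr (\<alpha> / 2) \<and>
        (general_sombor \<alpha> G = real (forgotten_index G) powr (\<alpha> / 2) \<longleftrightarrow>
           graph_iso G (disjoint_union (complete_graph 2) (graph_complement (complete_graph (n - 2)))) \<or>
           graph_iso G (graph_complement (complete_graph n)))) \<and>
     (\<alpha> < 0 \<longrightarrow>
        general_sombor \<alpha> G \<le> 2 powr (- 1 + \<alpha> / 2) * real n * (real n - 1) \<and>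
        (general_sombor \<alpha> G = 2 powr (- 1 + \<alpha> / 2) * real n * (real n - 1) \<longleftrightarrow>
           graph_iso G (complete_graph 2))) \<and>
     (\<alpha> > 1 \<longrightarrow>
        general_sombor \<alpha> G \<le> 2 powr (\<alpha> / 2) * real m * (real n - 1) powr \<alpha> \<and>
        (general_sombor \<alpha> G = 2 powr (\<alpha> / 2) * real m * (real n - 1) powr \<alpha> \<longleftrightarrow>
           graph_iso G (complete_graph n) \<or>
           graph_iso G (graph_complement (complete_graph n))))"
proof -
  note G = assms(1)
  have n: "card (verts G) = n" and m: "card (edges G) = m"
    using assms by auto
  have choose: "2 * real (n choose 2) = real n * (real n - 1)"
  proof -
    \<comment> \<open>Parity makes the natural division by 2 in \<open>choose_two\<close>
      exact.\<close>
    have "even (n * (n - 1))"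
      by auto
    then have "2 * (n choose 2) = n * (n - 1)"
      unfolding choose_two by (rule dvd_mult_div_cancel)
    then have "real (2 * (n choose 2)) = real (n * (n - 1))"
      by (rule arg_cong)
    then show ?thesis
      using assms(3) by (simp add: of_nat_diff)
  qed
  show ?thesis
  proof (rule conjI[OF impI conjI[OF impI impI]])
    assume "0 < \<alpha> \<and> \<alpha> < 1"
    then have "\<alpha> < 2"
      by simp
    from general_sombor_ge[OF G this]
    show "general_sombor \<alpha> G \<ge> real (forgotten_index G) powr (\<alpha> / 2) \<and>
        (general_sombor \<alpha> G = real (forgotten_index G) powr (\<alpha> / 2) \<longleftrightarrow>
           graph_iso G (disjoint_union (complete_graph 2) (graph_complement (complete_graph (n - 2)))) \<or>
           graph_iso G (graph_complement (complete_graph n)))"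
      using graph_iso_single_edge_iff[OF G] graph_iso_edgeless_iff[OF G] by (simp add: n)
  next
    assume \<alpha>: "\<alpha> < 0"
    let ?q = "2 powr (\<alpha> / 2) :: real"
    \<comment> \<open>The stated bound is the value that would arise if all
      \<open>n choose 2\<close> pairs were edges of the minimal weight \<open>2\<close>.\<close>
    have rhs: "2 powr (- 1 + \<alpha> / 2) * real n * (real n - 1) = real (n choose 2) * ?q"
    proof -
      have "2 powr (- 1 + \<alpha> / 2) = ?q / 2"
        by (simp only: powr_add) (simp add: powr_minus)
      then show ?thesis
        using choose by (simp add: mult.assoc flip: choose)
    qed
    have mle: "real m * ?q \<le> real (n choose 2) * ?q"
      using card_edges_le[OF G] by (simp add: n m)
    have "general_sombor \<alpha> G = real (n choose 2) * ?q \<longleftrightarrow> graph_iso G (complete_graph 2)"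
    proof
      \<comment> \<open>Since \<open>real m * ?q\<close> lies between the two sides, equality holds
        in both estimates: all pairs are edges, and all edges have weight \<open>2\<close>.\<close>
      assume "general_sombor \<alpha> G = real (n choose 2) * ?q"
      then have "real m * ?q = real (n choose 2) * ?q"
        and eq: "general_sombor \<alpha> G = real (card (edges G)) * ?q"
        using general_sombor_le_neg(1)[OF G \<alpha>] mle by (auto simp: m)
      then have mc: "m = n choose 2"
        by simp
      then have "m > 0"
        using assms(3) by (simp add: zero_less_binomial)
      then obtain e where e: "e \<in> edges G"
        using m by (metis card.empty equals0I less_irrefl)
      then obtain u where u: "u \<in> e"
        using fin_simple_graph_edgeE[OF G] by blast
      \<comment> \<open>Minimal weight gives degree 1 and completeness gives degree
        \<open>n - 1\<close>; both hold at \<open>u\<close> only if \<open>n = 2\<close>.\<close>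
      have "degree G u = 1"
        using eq general_sombor_le_neg(2)[OF G \<alpha>] e u by blast
      moreover have "degree G u = n - 1"
        using all_edges_max_degree_iff[OF G] mc e u by (simp add: n m)
      ultimately have "n = 2"
        using assms(3) by simp
      then show "graph_iso G (complete_graph 2)"
        using graph_iso_complete_iff[OF G] mc by (simp add: n m)
    next
      assume "graph_iso G (complete_graph 2)"
      then have n2: "n = 2" and mc: "m = n choose 2"
        using graph_iso_complete_iff[OF G] by (simp_all add: n m)
      \<comment> \<open>On two vertices the full degree \<open>n - 1\<close> coincides with the
        least degree 1 of an endpoint.\<close>
      then have "\<forall>e\<in>edges G. \<forall>u\<in>e. degree G u = 1"
        using all_edges_max_degree_iff[OF G] by (simp add: n m)
      then show "general_sombor \<alpha> G = real (n choose 2) * ?q"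
        using general_sombor_le_neg(2)[OF G \<alpha>] mc by (simp add: m)
    qed
    then show "general_sombor \<alpha> G \<le> 2 powr (- 1 + \<alpha> / 2) * real n * (real n - 1) \<and>
        (general_sombor \<alpha> G = 2 powr (- 1 + \<alpha> / 2) * real n * (real n - 1) \<longleftrightarrow>
           graph_iso G (complete_graph 2))"
      unfolding rhs using order_trans[OF general_sombor_le_neg(1)[OF G \<alpha>, unfolded m] mle] by simp
  next
    assume "\<alpha> > 1"
    then have "\<alpha> > 0"
      by simp
    from general_sombor_le_pos[OF G this]
    show "general_sombor \<alpha> G \<le> 2 powr (\<alpha> / 2) * real m * (real n - 1) powr \<alpha> \<and>
        (general_sombor \<alpha> G = 2 powr (\<alpha> / 2) * real m * (real n - 1) powr \<alpha> \<longleftrightarrow>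
           graph_iso G (complete_graph n) \<or>
           graph_iso G (graph_complement (complete_graph n)))"
      using all_edges_max_degree_iff[OF G] graph_iso_complete_iff[OF G, of n]
        graph_iso_edgeless_iff[OF G]
      by (simp add: n m mult_ac)
  qed
qed

end
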